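(* For any integers $k, g \ge 2$ and any real $\epsilon > 0$, there is a (finite, simple) graph $G$ of girth at least $g$ such that $\chi(G)=k$ and $\chi_c^s(G) > 2k-\epsilon$.
   Context: A signed graph $(G,\sigma)$ is a graph $G$ with a signature $\sigma:E(G)\to\{+,-\}$. For real $r\ge 1$, $C^r$ is the circle of circumference $r$ (points are $[0,r)$), $d_{(\mathrm{mod}\, r)}(x,y)$ is the length of the shorter arc of $C^r$ between $x$ and $y$, and the antipodal $\bar x$ of $x$ is the point at distance $r/2$ from $x$. A circular $r$-coloring of $(G,\sigma)$ is a map $f:V(G)\to C^r$ such that $d_{(\mathrm{mod}\, r)}(f(u),f(v))\ge 1$ for each positive edge $uv$ and $d_{(\mathrm{mod}\, r)}(f(u),\overline{f(v)})\ge 1$ for each negative edge $uv$. The circular chromatic number is $\chi_c(G,\sigma)=\inf\{r\ge 1: (G,\sigma)\text{ admits a circular } r\text{-coloring}\}$. For a simple graph $G$, the signed circular chromatic number is $\chi_c^s(G)=\max\{\chi_c(G,\sigma):\sigma\text{ is a signature of }G\}$. $\chi(G)$ is the ordinary chromatic number. *)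

theory Defs
  imports Complex_Main "HOL-Library.Extended_Nat" "HOL-Library.FuncSet"
begin

definition simple_graph :: "'a set \<Rightarrow> 'a set set \<Rightarrow> bool" where
  "simple_graph V E \<longleftrightarrow> finite V \<and> E \<subseteq> {{u, v} | u v. u \<in> V \<and> v \<in> V \<and> u \<noteq> v}"

(* A cycle is given by its vertices in cyclic order, without repeating the first one at the end. *)
definition is_cycle :: "'a set set \<Rightarrow> 'a list \<Rightarrow> bool" where
  "is_cycle E p \<longleftrightarrow> 3 \<le> length p \<and> distinct p \<and>
     (\<forall>i < length p. {p ! i, p ! (Suc i mod length p)} \<in> E)"

(* The girth of a forest is infinite. *)
definition girth :: "'a set set \<Rightarrow> enat" where
  "girth E = (INF p \<in> Collect (is_cycle E). enat (length p))"

definition proper_colouring :: "'a set \<Rightarrow> 'a set set \<Rightarrow> nat \<Rightarrow> ('a \<Rightarrow> nat) \<Rightarrow> bool" where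
  "proper_colouring V E n c \<longleftrightarrow> c \<in> V \<rightarrow> {..<n} \<and> (\<forall>u v. {u, v} \<in> E \<longrightarrow> c u \<noteq> c v)"

definition chromatic_number :: "'a set \<Rightarrow> 'a set set \<Rightarrow> nat" where
  "chromatic_number V E = (LEAST n. \<exists>c. proper_colouring V E n c)"

definition circle :: "real \<Rightarrow> real set" where
  "circle r = {0..<r}"

definition circ_dist :: "real \<Rightarrow> real \<Rightarrow> real \<Rightarrow> real" where
  "circ_dist r x y = min \<bar>x - y\<bar> (r - \<bar>x - y\<bar>)"

definition antipode :: "real \<Rightarrow> real \<Rightarrow> real" where
  "antipode r x = (THE y. y \<in> circle r \<and> circ_dist r x y = r / 2)"

lemma antipode_eq:
  assumes "x \<in> circle r"
  shows "antipode r x = (if x < r / 2 then x + r / 2 else x - r / 2)"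
  unfolding antipode_def
proof (rule the_equality)
  show "(if x < r / 2 then x + r / 2 else x - r / 2) \<in> circle r \<and>
        circ_dist r x (if x < r / 2 then x + r / 2 else x - r / 2) = r / 2"
    using assms by (auto simp: circle_def circ_dist_def)
next
  fix y assume "y \<in> circle r \<and> circ_dist r x y = r / 2"
  then show "y = (if x < r / 2 then x + r / 2 else x - r / 2)"
    using assms by (auto simp: circle_def circ_dist_def min_def abs_if split: if_splits)
qed

datatype sign = Pos | Neg

(* Signatures are extensional functions on the edge set, so that a finite graph has only
   finitely many of them. *)
definition signatures :: "'a set set \<Rightarrow> ('a set \<Rightarrow> sign) set" where
  "signatures E = (E \<rightarrow>\<^sub>E UNIV)"

(* The condition on a negative edge is symmetric in its ends, so quantifying over both
   orientations of an edge is harmless. *)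
definition circular_colouring ::
    "'a set \<Rightarrow> 'a set set \<Rightarrow> ('a set \<Rightarrow> sign) \<Rightarrow> real \<Rightarrow> ('a \<Rightarrow> real) \<Rightarrow> bool" where
  "circular_colouring V E \<sigma> r f \<longleftrightarrow> f \<in> V \<rightarrow> circle r \<and>
     (\<forall>u v. {u, v} \<in> E \<longrightarrow>
        (\<sigma> {u, v} = Pos \<longrightarrow> circ_dist r (f u) (f v) \<ge> 1) \<and>
        (\<sigma> {u, v} = Neg \<longrightarrow> circ_dist r (f u) (antipode r (f v)) \<ge> 1))"

definition circular_chromatic_number :: "'a set \<Rightarrow> 'a set set \<Rightarrow> ('a set \<Rightarrow> sign) \<Rightarrow> real" where
  "circular_chromatic_number V E \<sigma> = Inf {r. r \<ge> 1 \<and> (\<exists>f. circular_colouring V E \<sigma> r f)}"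

definition signed_circular_chromatic_number :: "'a set \<Rightarrow> 'a set set \<Rightarrow> real" where
  "signed_circular_chromatic_number V E = Max (circular_chromatic_number V E ` signatures E)"

end

(* Take k disjoint vertex classes of large size n. The graph is sparse but such that any two
   subsets of size at least n/N of distinct classes are joined by both a positive and a negative
   edge. It is built greedily: edges join vertices of small degree at distance more than g, and
   averaging over all candidates shows that some edge settles a constant fraction c of the
   not yet settled triples (A, B, sign). There are only exponentially many triples, so linearly
   many edges suffice, and linearly many edges of bounded degree exclude few candidates.

   Given a circular r-colouring with r < 2k - epsilon, cut the circle into N arcs and choose an arc
   that is popular in each class. Modulo r/2, which identifies antipodal points, two of these k
   arcs are at distance less than 1 - epsilon/(2k), and the edges of either sign between them
   contradict the colouring. A proper q-colouring is a circular 2q-colouring for every signature,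
   so the same bound gives the chromatic number. *)

theory Submission
  imports Defs
begin

section \<open>Walks, cycles and ball sizes\<close>

text \<open>Ordered pairs rather than edges, so that relational powers express walks and images
  express neighbourhoods.\<close>

definition adj :: "'a set set \<Rightarrow> ('a \<times> 'a) set" where
  "adj E = {(x, y). {x, y} \<in> E}"

lemma sym_adj_relpow: "(x, y) \<in> adj E ^^ n \<Longrightarrow> (y, x) \<in> adj E ^^ n"
proof (induction n arbitrary: y)
  case (Suc n)
  then obtain z where "(x, z) \<in> adj E ^^ n" "(z, y) \<in> adj E" by auto
  then show ?case
    using Suc.IH[of z] relpow_Suc_I2[of y z "adj E" x n] by (auto simp: adj_def insert_commute)
qed auto

text \<open>Removing the new edge from a cycle through it leaves a walk between \<open>u\<close> and
  \<open>v\<close> along old edges. Hence joining only vertices that are far apart creates no short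
  cycle.\<close>

lemma cycle_insert:
  assumes "is_cycle (insert {u, v} E) p"
  shows "is_cycle E p \<or> (u, v) \<in> adj E ^^ (length p - 1)"
proof (cases "is_cycle E p")
  case False
  define n where "n = length p"
  have n: "3 \<le> n" and dist: "distinct p"
    and edge: "\<And>i. i < n \<Longrightarrow> {p ! i, p ! (Suc i mod n)} \<in> insert {u, v} E"
    using assms by (auto simp: is_cycle_def n_def)
  obtain i where i: "i < n" "{p ! i, p ! (Suc i mod n)} \<notin> E"
    using False n dist by (auto simp: is_cycle_def n_def)
  have uv: "{p ! i, p ! (Suc i mod n)} = {u, v}"
    using edge[OF i(1)] i(2) by auto
  \<comment> \<open>The edge \<open>{u, v}\<close> occurs at one position only: a second occurrence
    would run in the opposite direction, which forces a cycle of length at most 2.\<close>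
  have uniq: "j = i" if j: "j < n" "{p ! j, p ! (Suc j mod n)} = {u, v}" for j
  proof -
    have "{p ! j, p ! (Suc j mod n)} = {p ! i, p ! (Suc i mod n)}"
      using j(2) uv by simp
    then have "j = i \<or> (j = Suc i mod n \<and> i = Suc j mod n)"
      using nth_eq_iff_index_eq[OF dist, folded n_def, of j "Suc i mod n"] i(1) j(1) n
        nth_eq_iff_index_eq[OF dist, folded n_def, of i "Suc j mod n"]
        nth_eq_iff_index_eq[OF dist, folded n_def, of j i]
      by (auto simp: doubleton_eq_iff)
    then show ?thesis
      using n i(1) j(1) by (auto simp: mod_Suc split: if_splits)
  qed
  \<comment> \<open>\<open>w\<close> goes once round the cycle from just after position
    \<open>i\<close>. It reaches \<open>p ! i\<close> at \<open>w (n - 1)\<close> without crossing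
    the edge at position \<open>i\<close>.\<close>
  define w where "w l = p ! ((Suc i + l) mod n)" for l
  have "(w 0, w l) \<in> adj E ^^ l" if "l < n" for l
    using that
  proof (induction l)
    case (Suc l)
    let ?j = "(Suc i + l) mod n"
    have "?j \<noteq> i"
    proof (cases "Suc i + l < n")
      case False
      then have "?j = Suc i + l - n"
        using i(1) Suc.prems by (simp add: mod_if)
      then show ?thesis using False Suc.prems by auto
    qed auto
    moreover have "?j < n" using n by simp
    ultimately have "{p ! ?j, p ! (Suc ?j mod n)} \<in> E"
      using edge[of ?j] uniq[of ?j] by blast
    then have "(w l, w (Suc l)) \<in> adj E"
      by (simp add: w_def adj_def mod_Suc_eq)
    with Suc show ?case by auto
  qed auto
  from this[of "n - 1"] have "(p ! (Suc i mod n), p ! i) \<in> adj E ^^ (n - 1)"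
    using n i(1) by (simp add: w_def)
  moreover have "p ! i = u \<and> p ! (Suc i mod n) = v \<or> p ! i = v \<and> p ! (Suc i mod n) = u"
    using uv by (simp add: doubleton_eq_iff)
  ultimately show ?thesis
    using sym_adj_relpow unfolding n_def by metis
qed simp

lemma card_adj_le:
  assumes "finite E"
  shows "finite (adj E)" and "card (adj E) \<le> 2 * card E"
proof -
  have fib: "finite {(x, y). {x, y} = e} \<and> card {(x, y). {x, y} = e} \<le> 2" for e :: "'a set"
  proof (cases "{(x, y). {x, y} = e} = {}")
    case False
    then obtain a b where e: "e = {a, b}" by auto
    have sub: "{(x, y). {x, y} = e} \<subseteq> {(a, b), (b, a)}"
    proof (rule subrelI)
      fix x y assume "(x, y) \<in> {(x, y). {x, y} = e}"
      then have "{x, y} = {a, b}" using e by simp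
      then show "(x, y) \<in> {(a, b), (b, a)}" unfolding doubleton_eq_iff by blast
    qed
    have "card {(x, y). {x, y} = e} \<le> card {(a, b), (b, a)}"
      by (rule card_mono[OF _ sub]) simp
    also have "\<dots> \<le> 2" using card_insert_le_m1[of 2 "{(b, a)}" "(a, b)"] by simp
    finally show ?thesis using finite_subset[OF sub] by simp
  qed (simp only: finite.emptyI card.empty, simp)
  have adj: "adj E = (\<Union>e\<in>E. {(x, y). {x, y} = e})" by (auto simp: adj_def)
  show "finite (adj E)" unfolding adj using fib assms by simp
  have "card (adj E) \<le> (\<Sum>e\<in>E. card {(x, y). {x, y} = e})"
    unfolding adj by (rule card_UN_le[OF assms])
  also have "\<dots> \<le> (\<Sum>e\<in>E. 2)" using fib by (intro sum_mono) auto
  finally show "card (adj E) \<le> 2 * card E" by simp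
qed

text \<open>Balls of fixed radius have a size independent of the number of vertices, so they are
  negligible in a large graph of bounded degree.\<close>

lemma card_relpow_Image_le:
  fixes R :: "('a \<times> 'a) set"
  assumes "\<And>x. finite (R `` {x}) \<and> card (R `` {x}) \<le> D"
  shows "finite ((R ^^ l) `` {x}) \<and> card ((R ^^ l) `` {x}) \<le> D ^ l"
proof (induction l)
  case (Suc l)
  have eq: "(R ^^ Suc l) `` {x} = (\<Union>y\<in>(R ^^ l) `` {x}. R `` {y})" by auto
  have "card ((R ^^ Suc l) `` {x}) \<le> (\<Sum>y\<in>(R ^^ l) `` {x}. card (R `` {y}))"
    unfolding eq using Suc by (intro card_UN_le) auto
  also have "\<dots> \<le> (\<Sum>y\<in>(R ^^ l) `` {x}. D)" using assms by (intro sum_mono) auto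
  also have "\<dots> \<le> D ^ Suc l" using Suc by simp
  finally show ?case unfolding eq using Suc assms by simp
qed auto

section \<open>Greedy construction of a sparse graph\<close>

text \<open>Double counting of the pairs \<open>(i, x)\<close> with \<open>x \<in> H i\<close>: an
  average element of \<open>X\<close> already lies in the required number of sets.\<close>

lemma ex_frequent_element:
  fixes c :: real
  assumes "finite X" "X \<noteq> {}" "finite I"
    and H: "\<And>i. i \<in> I \<Longrightarrow> H i \<subseteq> X \<and> c * card X \<le> card (H i)"
  shows "\<exists>x\<in>X. c * card I \<le> card {i \<in> I. x \<in> H i}"
proof (rule ccontr)
  assume "\<not> ?thesis"
  then have "(\<Sum>x\<in>X. real (card {i \<in> I. x \<in> H i})) < (\<Sum>x\<in>X. c * card I)"
    using assms by (intro sum_strict_mono) auto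
  also have "\<dots> = (\<Sum>i\<in>I. c * card X)" by simp
  also have "\<dots> \<le> (\<Sum>i\<in>I. real (card {x \<in> X. x \<in> H i}))"
  proof (intro sum_mono)
    fix i assume "i \<in> I"
    with H have "{x \<in> X. x \<in> H i} = H i" by auto
    with H \<open>i \<in> I\<close> show "c * card X \<le> real (card {x \<in> X. x \<in> H i})" by simp
  qed
  also have "\<dots> = (\<Sum>x\<in>X. real (card {i \<in> I. x \<in> H i}))"
    using sum_multicount_gen[of I X "\<lambda>i x. x \<in> H i" "\<lambda>x. card {i \<in> I. x \<in> H i}"] assms
    by (simp flip: of_nat_sum)
  finally show False by simp
qed

text \<open>The triples not yet settled. Only the values of \<open>\<sigma>\<close> on
  \<open>E\<close> matter, so the labelling may be a total function that is updated at each new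
  edge.\<close>

definition unhit :: "'a set set \<Rightarrow> ('a set \<Rightarrow> 'l) \<Rightarrow> ('a set \<times> 'a set \<times> 'l) set \<Rightarrow>
    ('a set \<times> 'a set \<times> 'l) set" where
  "unhit E \<sigma> \<B> = {(A, B, s) \<in> \<B>. \<forall>u\<in>A. \<forall>v\<in>B. {u, v} \<in> E \<longrightarrow> \<sigma> {u, v} \<noteq> s}"

text \<open>Every unsettled triple is settled by many admissible candidates
  \<open>(u, v, s)\<close>: saturated vertices and a ball around \<open>u\<close> each cost at most
  a quarter of \<open>\<delta> * card V\<close>, leaving at least half of that amount for
  \<open>u\<close> and, given \<open>u\<close>, for \<open>v\<close>. Averaging over all of
  \<open>V \<times> V \<times> L\<close> yields one candidate that is good for the fraction
  \<open>\<delta>\<^sup>2 / (4 * card L)\<close> of the triples.\<close>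

lemma greedy_step:
  fixes \<delta> :: real and D T g :: nat
  assumes V: "finite V" "V \<noteq> {}" and L: "finite L" "L \<noteq> {}" and \<B>: "\<B> \<subseteq> Pow V \<times> Pow V \<times> L"
    and big: "\<And>A B s. (A, B, s) \<in> \<B> \<Longrightarrow> \<delta> * card V \<le> card A \<and> \<delta> * card V \<le> card B"
    and \<delta>: "\<delta> > 0"
    and E: "finite E" "card E \<le> T" and deg: "\<And>x. card (adj E `` {x}) \<le> D"
    and T: "8 * real T \<le> \<delta> * card V * D" and C: "4 * (\<Sum>l\<le>g. real D ^ l) \<le> \<delta> * card V"
    and "D > 0" and "g > 0" and unhit: "unhit E \<sigma> \<B> \<noteq> {}"
  shows "\<exists>A B s u v. (A, B, s) \<in> \<B> \<and> u \<in> A \<and> v \<in> B \<and>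
    card (adj E `` {u}) < D \<and> card (adj E `` {v}) < D \<and> (\<forall>l\<le>g. (u, v) \<notin> adj E ^^ l) \<and>
    card (unhit (insert {u, v} E) (\<sigma>({u, v} := s)) \<B>)
      \<le> (1 - \<delta>\<^sup>2 / (4 * card L)) * card (unhit E \<sigma> \<B>)"
proof -
  let ?U = "unhit E \<sigma> \<B>"
  let ?c = "\<delta>\<^sup>2 / (4 * card L)"
  define m where "m = real (card V)"
  have m: "m > 0" using V by (simp add: m_def card_gt_0_iff)
  have fin\<B>: "finite \<B>" using V L by (intro finite_subset[OF \<B>]) auto
  have U: "?U \<subseteq> \<B>" by (auto simp: unhit_def)
  have finU: "finite ?U" using U fin\<B> finite_subset by blast
  \<comment> \<open>An edge \<open>uv\<close> may be added unless \<open>u\<close> or \<open>v\<close> is in \<open>S\<close> or \<open>v\<close> is in \<open>ball u\<close>.\<close>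
  define S where "S = {x \<in> V. D \<le> card (adj E `` {x})}"
  define ball where "ball x = (\<Union>l\<le>g. (adj E ^^ l) `` {x})" for x
  have finN: "finite (adj E `` {x})" for x
    using card_adj_le(1)[OF E(1)] by (rule finite_Image)
  have ball: "finite (ball x) \<and> real (card (ball x)) \<le> \<delta> * m / 4" for x
  proof -
    have fin: "finite ((adj E ^^ l) `` {x}) \<and> card ((adj E ^^ l) `` {x}) \<le> D ^ l" for l
      using finN deg by (intro card_relpow_Image_le) auto
    have "card (ball x) \<le> (\<Sum>l\<le>g. card ((adj E ^^ l) `` {x}))"
      unfolding ball_def by (rule card_UN_le) auto
    also have "\<dots> \<le> (\<Sum>l\<le>g. D ^ l)" using fin by (intro sum_mono) auto
    finally have "real (card (ball x)) \<le> (\<Sum>l\<le>g. real D ^ l)"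
      by (simp flip: of_nat_power of_nat_sum)
    then show ?thesis using C fin by (auto simp: ball_def m_def)
  qed
  have finS: "finite S" using V by (simp add: S_def)
  \<comment> \<open>Markov's inequality for degrees: their sum is at most
    \<open>2 * T\<close>.\<close>
  have S: "real (card S) \<le> \<delta> * m / 4"
  proof -
    have "card S * D = (\<Sum>x\<in>S. D)" by simp
    also have "\<dots> \<le> (\<Sum>x\<in>S. card (adj E `` {x}))" by (intro sum_mono) (auto simp: S_def)
    also have "\<dots> = card (SIGMA x:S. adj E `` {x})" using finS finN by (simp add: card_SigmaI)
    also have "\<dots> \<le> card (adj E)" using card_adj_le(1)[OF E(1)] by (intro card_mono) auto
    also have "\<dots> \<le> 2 * T" using card_adj_le(2)[OF E(1)] E(2) by simp
    finally have "real (card S) * D \<le> 2 * real T"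
      by (simp flip: of_nat_mult)
    then have "real (card S) * D \<le> \<delta> * m / 4 * D" using T by (simp add: m_def)
    then show ?thesis using \<open>D > 0\<close> by simp
  qed
  \<comment> \<open>The admissible candidates that settle a given triple.\<close>
  define H where "H = (\<lambda>(A, B, s :: 'b).
    (\<lambda>(u, v). (u, v, s)) ` (SIGMA u:A - S. B - S - ball u))"
  define X where "X = V \<times> V \<times> L"
  have cardX: "real (card X) = m\<^sup>2 * card L"
    by (simp add: X_def m_def card_cartesian_product power2_eq_square)
  have H: "H b \<subseteq> X \<and> ?c * card X \<le> card (H b)" if "b \<in> ?U" for b
  proof -
    obtain A B s where b: "b = (A, B, s)" by (cases b)
    have mem: "(A, B, s) \<in> \<B>" using that U b by auto
    then have sub: "A \<subseteq> V" "B \<subseteq> V" "s \<in> L" using \<B> by auto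
    then have fin: "finite A" "finite B" using V finite_subset by auto
    have bigAB: "\<delta> * m \<le> card A" "\<delta> * m \<le> card B" using big[OF mem] by (auto simp: m_def)
    have 1: "\<delta> * m / 2 \<le> real (card (B - S - ball u))" for u
    proof -
      have "B - S - ball u = B - (S \<union> ball u)" by blast
      then have "real (card B) \<le> card (B - S - ball u) + card (S \<union> ball u)"
        using diff_card_le_card_Diff[of "S \<union> ball u" B] finS ball[of u] by simp
      also have "card (S \<union> ball u) \<le> card S + card (ball u)" by (rule card_Un_le)
      finally show ?thesis using bigAB(2) S ball[of u] by simp
    qed
    have 2: "\<delta> * m / 2 \<le> card (A - S)"
    proof -
      have "real (card A) \<le> card (A - S) + card S"
        using diff_card_le_card_Diff[OF finS, of A] by linarith
      then show ?thesis using bigAB(1) S m \<delta> by simp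
    qed
    have "\<delta>\<^sup>2 * m\<^sup>2 / 4 = (\<delta> * m / 2) * (\<delta> * m / 2)" by (simp add: power2_eq_square)
    also have "\<dots> \<le> card (A - S) * (\<delta> * m / 2)"
      using 2 m \<delta> by (intro mult_right_mono) auto
    also have "\<dots> = (\<Sum>u\<in>A - S. \<delta> * m / 2)" by simp
    also have "\<dots> \<le> (\<Sum>u\<in>A - S. real (card (B - S - ball u)))" by (intro sum_mono 1)
    also have "\<dots> = card (SIGMA u:A - S. B - S - ball u)" using fin by (simp add: card_SigmaI)
    also have "\<dots> = card (H b)" unfolding H_def b prod.case
      by (subst card_image) (auto simp: inj_on_def)
    finally have "\<delta>\<^sup>2 * m\<^sup>2 / 4 \<le> card (H b)" .
    then show ?thesis using sub L cardX by (auto simp: H_def b X_def)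
  qed
  have "X \<noteq> {}" "finite X" using V L by (auto simp: X_def)
  obtain x where x: "?c * card ?U \<le> card {b \<in> ?U. x \<in> H b}"
    using ex_frequent_element[OF \<open>finite X\<close> \<open>X \<noteq> {}\<close> finU, of H ?c] H by blast
  obtain u v s where uvs: "x = (u, v, s)" by (cases x)
  \<comment> \<open>The popular candidate lies in some \<open>H b\<close>, and this membership is
    what makes its pair \<open>u\<close>, \<open>v\<close> admissible.\<close>
  have "0 < ?c * card ?U"
    using unhit finU L \<delta> by (simp add: card_gt_0_iff)
  then have "0 < card {b \<in> ?U. x \<in> H b}" using x by linarith
  then obtain A B s' where AB: "(A, B, s') \<in> ?U" "x \<in> H (A, B, s')"
    unfolding card_gt_0_iff by fast
  then have s: "s' = s" "u \<in> A - S" "v \<in> B - S - ball u" by (auto simp: H_def uvs)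
  have memB: "(A, B, s) \<in> \<B>" using AB(1) U s by auto
  then have "u \<in> V" "v \<in> V" using \<B> s by auto
  let ?U' = "unhit (insert {u, v} E) (\<sigma>({u, v} := s)) \<B>"
  have far: "\<forall>l\<le>g. (u, v) \<notin> adj E ^^ l" using s(3) by (auto simp: ball_def)
  \<comment> \<open>The edge is new, so updating \<open>\<sigma>\<close> there cannot unsettle a
    triple.\<close>
  then have "(u, v) \<notin> adj E ^^ 1" using \<open>g > 0\<close> by (auto dest: spec[of _ 1])
  then have notE: "{u, v} \<notin> E" by (simp add: adj_def)
  have "?U' \<subseteq> ?U - {b \<in> ?U. x \<in> H b}"
  proof
    fix b assume b: "b \<in> ?U'"
    obtain A' B' s1 where b_eq: "b = (A', B', s1)" by (cases b)
    have mem: "(A', B', s1) \<in> \<B>"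
      and miss: "\<And>x y. x \<in> A' \<Longrightarrow> y \<in> B' \<Longrightarrow> {x, y} \<in> insert {u, v} E \<Longrightarrow>
        (\<sigma>({u, v} := s)) {x, y} \<noteq> s1"
      using b unfolding unhit_def b_eq by blast+
    have "\<sigma> {x, y} \<noteq> s1" if "x \<in> A'" "y \<in> B'" "{x, y} \<in> E" for x y
    proof -
      have "{x, y} \<noteq> {u, v}" using that(3) notE by auto
      then show ?thesis using miss[of x y] that by simp
    qed
    moreover have "x \<notin> H b"
      using miss[of u v] by (auto simp: H_def b_eq uvs)
    ultimately show "b \<in> ?U - {b \<in> ?U. x \<in> H b}"
      using mem unfolding unhit_def b_eq by blast
  qed
  then have "card ?U' \<le> card (?U - {b \<in> ?U. x \<in> H b})" using finU by (intro card_mono) auto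
  also have "\<dots> = card ?U - card {b \<in> ?U. x \<in> H b}" using finU by (intro card_Diff_subset) auto
  finally have "card ?U' + card {b \<in> ?U. x \<in> H b} \<le> card ?U"
    using card_mono[OF finU, of "{b \<in> ?U. x \<in> H b}"] by auto
  then have "real (card ?U') + card {b \<in> ?U. x \<in> H b} \<le> card ?U"
    by linarith
  then have "real (card ?U') \<le> (1 - ?c) * card ?U" using x by (simp add: algebra_simps)
  moreover have "card (adj E `` {u}) < D" "card (adj E `` {v}) < D"
    using s \<open>u \<in> V\<close> \<open>v \<in> V\<close> by (auto simp: S_def)
  ultimately show ?thesis using memB s far by blast
qed

lemma card_neighbours_insert_le:
  assumes "finite E" "u \<noteq> v" "\<And>x. card (adj E `` {x}) \<le> D"
    and "card (adj E `` {u}) < D" "card (adj E `` {v}) < D"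
  shows "card (adj (insert {u, v} E) `` {x}) \<le> D"
proof -
  have fin: "finite (adj E `` {x})" for x
    using card_adj_le(1)[OF assms(1)] by (rule finite_Image)
  have sub: "adj (insert {u, v} E) `` {x} \<subseteq>
      (if x = u then insert v (adj E `` {u}) else if x = v then insert u (adj E `` {v}) else adj E `` {x})"
    using assms(2) by (auto simp: adj_def doubleton_eq_iff)
  have "card (adj (insert {u, v} E) `` {x}) \<le>
      card (if x = u then insert v (adj E `` {u}) else if x = v then insert u (adj E `` {v}) else adj E `` {x})"
    using sub by (rule card_mono[rotated]) (simp add: fin)
  also have "\<dots> \<le> D"
    using assms(3)[of x] assms(4,5) fin by (simp add: card_insert_if)
  finally show ?thesis .
qed

text \<open>With \<open>m\<close> vertices there are at most \<open>l * 4 ^ m\<close> triples, and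
  \<open>K * m\<close> greedy steps multiply the number of unsettled ones by at most
  \<open>(1 - c) ^ (K * m)\<close>. Since \<open>K\<close> satisfies
  \<open>(1 - c) ^ K * 4 * l < 1\<close>, fewer than one remains. The bound \<open>m\<^sub>0\<close>
  depends only on \<open>\<delta>\<close>, \<open>L\<close> and \<open>g\<close>.\<close>

lemma ex_sparse_hitting_graph:
  fixes \<delta> :: real and L :: "'l set" and g :: nat
  assumes \<delta>: "0 < \<delta>" "\<delta> \<le> 1" and L: "finite L" "L \<noteq> {}"
  shows "\<exists>m\<^sub>0. \<forall>(V :: 'a set) \<B>. finite V \<and> m\<^sub>0 \<le> card V \<and> \<B> \<subseteq> Pow V \<times> Pow V \<times> L \<and>
    (\<forall>(A, B, s)\<in>\<B>. \<delta> * card V \<le> card A \<and> \<delta> * card V \<le> card B) \<longrightarrow>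
    (\<exists>E \<sigma>. finite E \<and> (\<forall>p. is_cycle E p \<longrightarrow> g \<le> length p) \<and>
      (\<forall>e\<in>E. \<exists>(A, B, s)\<in>\<B>. \<exists>u\<in>A. \<exists>v\<in>B. e = {u, v}) \<and>
      (\<forall>(A, B, s)\<in>\<B>. \<exists>u\<in>A. \<exists>v\<in>B. {u, v} \<in> E \<and> \<sigma> {u, v} = s))"
proof -
  define l where "l = card L"
  have l: "1 \<le> l" using L by (simp add: l_def Suc_le_eq card_gt_0_iff)
  define c where "c = \<delta>\<^sup>2 / (4 * l)"
  have "\<delta>\<^sup>2 \<le> 1" using \<delta> by (simp add: power_le_one)
  then have c: "0 < c" "c < 1" using \<delta> l by (auto simp: c_def)
  obtain K where K: "(1 - c) ^ K < 1 / (4 * l)"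
    using real_arch_pow_inv[of "1 / (4 * l)" "1 - c"] c l by auto
  \<comment> \<open>Large enough that a graph with \<open>K * m\<close> edges has few vertices of
    degree \<open>D\<close>.\<close>
  define D where "D = nat \<lceil>8 * real K / \<delta>\<rceil> + 1"
  have "8 * real K / \<delta> \<le> D" unfolding D_def by linarith
  then have D: "0 < D" "8 * real K \<le> \<delta> * D" using \<delta> by (auto simp: D_def field_simps)
  \<comment> \<open>The radius \<open>Suc g\<close> is positive even for \<open>g = 0\<close>, as
    \<open>greedy_step\<close> demands.\<close>
  define C where "C = 4 * (\<Sum>i\<le>Suc g. real D ^ i)"
  define m\<^sub>0 where "m\<^sub>0 = nat \<lceil>C / \<delta>\<rceil> + 1"
  show ?thesis
  proof (intro exI[of _ m\<^sub>0] allI impI; elim conjE)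
    fix V :: "'a set" and \<B>
    assume V: "finite V" "m\<^sub>0 \<le> card V" and \<B>: "\<B> \<subseteq> Pow V \<times> Pow V \<times> L"
      and big: "\<forall>(A, B, s)\<in>\<B>. \<delta> * card V \<le> card A \<and> \<delta> * card V \<le> card B"
    define m where "m = card V"
    have m: "0 < m" using V by (simp add: m_def m\<^sub>0_def)
    have "C / \<delta> \<le> m" using V unfolding m_def m\<^sub>0_def by linarith
    then have C: "C \<le> \<delta> * m" using \<delta> by (simp add: field_simps)
    have "8 * real K * m \<le> \<delta> * D * m" using D m by (intro mult_right_mono) auto
    then have T: "8 * real (K * m) \<le> \<delta> * m * D" by (simp add: algebra_simps)
    \<comment> \<open>Edges only join the two sets of some triple; with triples taken between
      distinct classes, the graph becomes multipartite.\<close>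
    define edges where "edges = {e. \<exists>(A, B, s)\<in>\<B>. \<exists>u\<in>A. \<exists>v\<in>B. e = {u, v}}"
    \<comment> \<open>The number of edges is only bounded by \<open>t\<close>, because the graph is
      kept unchanged once every triple is settled.\<close>
    have "\<exists>E \<sigma>. finite E \<and> card E \<le> t \<and> (\<forall>x. card (adj E `` {x}) \<le> D) \<and> E \<subseteq> edges \<and>
        (\<forall>p. is_cycle E p \<longrightarrow> g \<le> length p) \<and> card (unhit E \<sigma> \<B>) \<le> (1 - c) ^ t * card \<B>"
      if "t \<le> K * m" for t
      using that
    proof (induction t)
      case 0
      have "\<not> is_cycle {} p" for p :: "'a list"
        unfolding is_cycle_def by (cases p) auto
      then show ?case
        by (intro exI[of _ "{}"] exI[of _ undefined]) (simp add: adj_def unhit_def)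
    next
      case (Suc t)
      then obtain E \<sigma> where E: "finite E" "card E \<le> t" "\<And>x. card (adj E `` {x}) \<le> D" "E \<subseteq> edges"
        and girth: "\<And>p. is_cycle E p \<Longrightarrow> g \<le> length p"
        and un: "card (unhit E \<sigma> \<B>) \<le> (1 - c) ^ t * card \<B>" by auto
      show ?case
      proof (cases "unhit E \<sigma> \<B> = {}")
        case True
        have "0 \<le> (1 - c) ^ Suc t * card \<B>" using c by simp
        then have "card (unhit E \<sigma> \<B>) \<le> (1 - c) ^ Suc t * card \<B>" using True by simp
        moreover have "card E \<le> Suc t" using E(2) by simp
        ultimately show ?thesis
          using E(1,3,4) girth by (intro exI[of _ E] exI[of _ \<sigma>] conjI allI impI)
      next
        case False
        have "V \<noteq> {}" using m by (auto simp: m_def)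
        moreover have "card E \<le> K * m" using E(2) Suc.prems by simp
        ultimately obtain A B s u v where new: "(A, B, s) \<in> \<B>" "u \<in> A" "v \<in> B"
          "card (adj E `` {u}) < D" "card (adj E `` {v}) < D"
          and dist: "\<forall>i\<le>Suc g. (u, v) \<notin> adj E ^^ i"
          and un': "card (unhit (insert {u, v} E) (\<sigma>({u, v} := s)) \<B>)
            \<le> (1 - c) * card (unhit E \<sigma> \<B>)"
          using greedy_step[of V L \<B> \<delta> E "K * m" D "Suc g" \<sigma>] V L \<B> big \<delta> E T C D False
          unfolding C_def c_def l_def m_def by fastforce
        \<comment> \<open>The excluded walk of length 0 rules out a loop.\<close>
        have "(u, v) \<notin> adj E ^^ 0" using dist by blast
        then have "u \<noteq> v" by simp
        have "{u, v} \<in> edges" unfolding edges_def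
          by (intro CollectI bexI[OF _ new(1)]) (use new(2,3) in auto)
        have "(1 - c) * card (unhit E \<sigma> \<B>) \<le> (1 - c) ^ Suc t * card \<B>"
          using mult_left_mono[OF un, of "1 - c"] c by (simp add: mult.assoc)
        with un' have "card (unhit (insert {u, v} E) (\<sigma>({u, v} := s)) \<B>)
            \<le> (1 - c) ^ Suc t * card \<B>" by (rule order_trans)
        moreover have "\<forall>p. is_cycle (insert {u, v} E) p \<longrightarrow> g \<le> length p"
        proof (intro allI impI)
          fix p assume cyc: "is_cycle (insert {u, v} E) p"
          show "g \<le> length p"
            using cycle_insert[OF cyc]
          proof
            assume "(u, v) \<in> adj E ^^ (length p - 1)"
            then have "\<not> length p - 1 \<le> Suc g" using dist by blast
            then show ?thesis by linarith
          qed (rule girth)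
        qed
        moreover have "card (insert {u, v} E) \<le> Suc t"
          using E(1,2) by (simp add: card_insert_if)
        moreover have "\<forall>x. card (adj (insert {u, v} E) `` {x}) \<le> D"
          using card_neighbours_insert_le[OF E(1) \<open>u \<noteq> v\<close> E(3) new(4,5)] by blast
        moreover have "finite (insert {u, v} E)" "insert {u, v} E \<subseteq> edges"
          using E \<open>{u, v} \<in> edges\<close> by auto
        ultimately show ?thesis
          by (intro exI[of _ "insert {u, v} E"] exI[of _ "\<sigma>({u, v} := s)"] conjI)
      qed
    qed
    from this[OF order_refl] obtain E \<sigma> where E: "finite E" "E \<subseteq> edges"
      "\<forall>p. is_cycle E p \<longrightarrow> g \<le> length p"
      and un: "card (unhit E \<sigma> \<B>) \<le> (1 - c) ^ (K * m) * card \<B>" by auto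
    have fin: "finite (Pow V \<times> Pow V \<times> L)" using V L by simp
    have fin\<B>: "finite \<B>" "card \<B> \<le> card (Pow V \<times> Pow V \<times> L)"
      using finite_subset[OF \<B> fin] card_mono[OF fin \<B>] by auto
    \<comment> \<open>\<open>4 ^ m\<close> counts the pairs of subsets of \<open>V\<close>.\<close>
    have "(4 :: nat) ^ m = 2 ^ m * 2 ^ m" by (simp flip: power_mult_distrib)
    then have "card (Pow V \<times> Pow V \<times> L) = l * 4 ^ m"
      using V by (simp add: card_cartesian_product card_Pow m_def l_def)
    moreover have "l * 4 ^ m \<le> (4 * l) ^ m"
      using self_le_power[OF l, of m] m by (simp add: power_mult_distrib)
    ultimately have "real (card \<B>) \<le> real ((4 * l) ^ m)"
      using fin\<B>(2) by (simp only: of_nat_le_iff)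
    then have "(1 - c) ^ (K * m) * card \<B> \<le> ((1 - c) ^ K) ^ m * (4 * real l) ^ m"
      using c unfolding power_mult by (intro mult_left_mono) auto
    also have "\<dots> = ((1 - c) ^ K * (4 * real l)) ^ m" by (simp add: power_mult_distrib)
    also have "\<dots> < 1 ^ m"
      using K l c m by (intro power_strict_mono) (auto simp: field_simps)
    finally have "card (unhit E \<sigma> \<B>) = 0" using un by simp
    moreover have "finite (unhit E \<sigma> \<B>)"
      by (rule finite_subset[OF _ fin\<B>(1)]) (auto simp: unhit_def)
    ultimately have "unhit E \<sigma> \<B> = {}" by simp
    then have hit: "\<exists>u\<in>A. \<exists>v\<in>B. {u, v} \<in> E \<and> \<sigma> {u, v} = s" if "(A, B, s) \<in> \<B>" for A B s
      using that by (auto simp: unhit_def)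
    show "\<exists>E \<sigma>. finite E \<and> (\<forall>p. is_cycle E p \<longrightarrow> g \<le> length p) \<and>
      (\<forall>e\<in>E. \<exists>(A, B, s)\<in>\<B>. \<exists>u\<in>A. \<exists>v\<in>B. e = {u, v}) \<and>
      (\<forall>(A, B, s)\<in>\<B>. \<exists>u\<in>A. \<exists>v\<in>B. {u, v} \<in> E \<and> \<sigma> {u, v} = s)"
    proof (intro exI[of _ E] exI[of _ \<sigma>] conjI ballI)
      fix e assume "e \<in> E"
      with E(2) show "\<exists>(A, B, s)\<in>\<B>. \<exists>u\<in>A. \<exists>v\<in>B. e = {u, v}"
        unfolding edges_def by (rule CollectD[OF subsetD])
    next
      fix b assume "b \<in> \<B>"
      then show "case b of (A, B, s) \<Rightarrow> \<exists>u\<in>A. \<exists>v\<in>B. {u, v} \<in> E \<and> \<sigma> {u, v} = s"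
        using hit by (cases b) simp
    qed (fact E)+
  qed
qed

section \<open>Distances on the circle\<close>

text \<open>On a circle of length \<open>L\<close>, the \<open>k\<close> gaps between cyclically
  consecutive points cannot all be at least \<open>d\<close>, as \<open>L < k * d\<close>. Plain
  bucketing by arcs of length \<open>d\<close> could use \<open>k\<close> buckets, one too many for
  the pigeonhole principle.\<close>

lemma close_pair_modulo:
  fixes p :: "nat \<Rightarrow> real" and L d :: real and k :: nat
  assumes "2 \<le> k" "0 < L" "0 < d" "L < k * d"
  shows "\<exists>i<k. \<exists>j<k. \<exists>t::int. i \<noteq> j \<and> \<bar>p i - p j - t * L\<bar> < d"
proof (rule ccontr)
  assume "\<not> ?thesis"
  then have far: "d \<le> \<bar>p i - p j - of_int t * L\<bar>" if "i < k" "j < k" "i \<noteq> j" for i j t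
    using that by (meson not_less)
  \<comment> \<open>Rotate so that \<open>p 0\<close> becomes \<open>0\<close>; then no point lies in the last arc of length \<open>d\<close>,
    which leaves only \<open>k - 1\<close> buckets of length \<open>d\<close>.\<close>
  define z where "z i = \<lfloor>(p i - p 0) / L\<rfloor>" for i
  define w where "w i = p i - p 0 - z i * L" for i
  have "real_of_int (z i) \<le> (p i - p 0) / L \<and> (p i - p 0) / L < z i + 1" for i
    unfolding z_def by linarith
  then have w: "0 \<le> w i" "w i < L" for i
    using \<open>0 < L\<close> by (auto simp: w_def field_simps)
  have bucket: "nat \<lfloor>w i / d\<rfloor> \<in> {..<k - 1}" if "i < k" for i
  proof -
    have "w i < (real k - 1) * d"
    proof (cases "i = 0")
      case True
      then show ?thesis using assms by (simp add: w_def z_def)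
    next
      case False
      \<comment> \<open>\<open>z i + 1\<close> compares \<open>p i\<close> with the copy of
        \<open>p 0\<close> one turn ahead, which gives
        \<open>w i \<le> L - d < (k - 1) * d\<close>.\<close>
      have "d \<le> \<bar>w i - L\<bar>"
        using far[of i 0 "z i + 1"] that False by (simp add: w_def algebra_simps)
      then show ?thesis using w[of i] assms(4) by (simp add: algebra_simps)
    qed
    then have "w i / d < real k - 1" using assms by (simp add: field_simps)
    then have "\<lfloor>w i / d\<rfloor> < int k - 1" by linarith
    then show ?thesis using assms(1) by auto
  qed
  have "\<not> inj_on (\<lambda>i. nat \<lfloor>w i / d\<rfloor>) {..<k}"
  proof
    assume "inj_on (\<lambda>i. nat \<lfloor>w i / d\<rfloor>) {..<k}"
    then have "card {..<k} \<le> card {..<k - 1}"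
      by (rule card_inj_on_le) (use bucket in auto)
    then show False using assms(1) by simp
  qed
  then obtain i j where ij: "i < k" "j < k" "i \<noteq> j" "nat \<lfloor>w i / d\<rfloor> = nat \<lfloor>w j / d\<rfloor>"
    by (auto simp: inj_on_def)
  have "0 \<le> \<lfloor>w i / d\<rfloor>" "0 \<le> \<lfloor>w j / d\<rfloor>" using w assms by auto
  with ij(4) have "\<lfloor>w i / d\<rfloor> = \<lfloor>w j / d\<rfloor>" by linarith
  then have "\<bar>w i / d - w j / d\<bar> < 1" by linarith
  then have "\<bar>w i - w j\<bar> < d"
    using assms by (simp add: field_simps flip: diff_divide_distrib)
  then show False
    using far[OF ij(1-3), of "z i - z j"] by (simp add: w_def algebra_simps)
qed

text \<open>As \<open>\<bar>x - y\<bar> < r\<close>, the representatives of \<open>x - y\<close>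
  modulo \<open>r\<close> are smallest in absolute value for some \<open>s\<close> among -1, 0 and
  1. This allows estimates on the real line without tracking wrap-around.\<close>

lemma circ_dist_le:
  assumes "x \<in> circle r" "y \<in> circle r"
  shows "circ_dist r x y \<le> \<bar>x - y - of_int s * r\<bar>"
proof -
  have xy: "\<bar>x - y\<bar> < r" using assms by (auto simp: circle_def)
  consider "s = 0" | "1 \<le> s" | "s \<le> -1" by linarith
  then show ?thesis
  proof cases
    case 2
    then have "1 * r \<le> of_int s * r" using xy by (intro mult_right_mono) auto
    then show ?thesis unfolding circ_dist_def using xy by linarith
  next
    case 3
    then have "of_int s * r \<le> -1 * r" using xy by (intro mult_right_mono) linarith+
    then show ?thesis unfolding circ_dist_def using xy by linarith
  qed (simp add: circ_dist_def)
qed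

text \<open>The antipode is a shift by half a turn, so odd multiples of \<open>r / 2\<close> replace
  the multiples of \<open>r\<close>.\<close>

lemma circ_dist_antipode_le:
  assumes "x \<in> circle r" "y \<in> circle r"
  shows "circ_dist r x (antipode r y) \<le> \<bar>x - y - of_int (2 * s + 1) * (r / 2)\<bar>"
proof (cases "y < r / 2")
  case True
  have "circ_dist r x (y + r / 2) \<le> \<bar>x - (y + r / 2) - of_int s * r\<bar>"
    using assms True by (intro circ_dist_le) (auto simp: circle_def)
  then show ?thesis unfolding antipode_eq[OF assms(2)] if_P[OF True]
    by (simp add: algebra_simps)
next
  case False
  \<comment> \<open>Here the antipode lies half a turn back, hence \<open>s + 1\<close> in place of
    \<open>s\<close>.\<close>
  have "circ_dist r x (y - r / 2) \<le> \<bar>x - (y - r / 2) - of_int (s + 1) * r\<bar>"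
    using assms False by (intro circ_dist_le) (auto simp: circle_def)
  then show ?thesis unfolding antipode_eq[OF assms(2)] if_not_P[OF False]
    by (simp add: algebra_simps)
qed

text \<open>The colours sit at the integers \<open>0\<close> to \<open>n - 1\<close> and their
  antipodes at \<open>n\<close> to \<open>2 * n - 1\<close>, so distinct colours are at distance at
  least 1 from each other and from each other's antipodes.\<close>

lemma circular_colouring_of_proper:
  assumes c: "proper_colouring V E n c" and E: "\<And>u v. {u, v} \<in> E \<Longrightarrow> u \<in> V \<and> v \<in> V"
  shows "circular_colouring V E \<sigma> (2 * real n) (\<lambda>v. real (c v))"
proof -
  have lt: "c v < n" if "v \<in> V" for v using c that by (auto simp: proper_colouring_def)
  have circ: "real (c v) \<in> circle (2 * real n)" if "v \<in> V" for v
    using lt[OF that] by (auto simp: circle_def)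
  have "1 \<le> circ_dist (2 * real n) (c u) (c v) \<and>
      1 \<le> circ_dist (2 * real n) (c u) (antipode (2 * real n) (c v))" if "{u, v} \<in> E" for u v
  proof -
    have "c u \<noteq> c v" using c that by (auto simp: proper_colouring_def)
    moreover have "c u < n" "c v < n" using E[OF that] lt by auto
    ultimately show ?thesis
      using antipode_eq[OF circ, of v] E[OF that]
      by (auto simp: circ_dist_def)
  qed
  then show ?thesis using circ by (auto simp: circular_colouring_def)
qed

section \<open>Lower bound on the circumference\<close>

lemma ex_popular_class:
  assumes "finite P" "card P = n" "h \<in> P \<rightarrow> {..<N}" "0 < n"
  shows "\<exists>a<N. n \<le> N * card {x \<in> P. h x = a}"
proof (rule ccontr)
  assume "\<not> ?thesis"
  then have small: "N * card {x \<in> P. h x = a} < n" if "a < N" for a using that by auto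
  have "0 < N" using assms by (cases N) (auto simp: card_gt_0_iff)
  have "n = (\<Sum>a<N. card {x \<in> P. h x = a})"
    using sum.group[of P "{..<N}" h "\<lambda>_. 1 :: nat"] assms by (auto simp: image_subset_iff Pi_iff)
  then have "N * n = (\<Sum>a<N. N * card {x \<in> P. h x = a})" by (simp add: sum_distrib_left)
  also have "\<dots> < (\<Sum>a<N. n)" using small \<open>0 < N\<close> by (intro sum_strict_mono) auto
  finally show False by simp
qed

text \<open>Two representatives of popular arcs are within
  \<open>d = 1 - \<epsilon> / (2 * k)\<close> modulo \<open>r / 2\<close>. Moving from them to the
  ends of an actual edge costs less than \<open>\<epsilon> / (4 * k)\<close> per end, so the total
  stays below 1.\<close>

lemma circular_colouring_circumference_ge:
  fixes \<epsilon> r :: real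
  assumes "2 \<le> k" "0 < n" "\<epsilon> \<le> 1" "8 * (real k)\<^sup>2 \<le> \<epsilon> * N" "1 \<le> r"
    and P: "\<And>i. i < k \<Longrightarrow> finite (P i) \<and> P i \<subseteq> V \<and> card (P i) = n"
    and hit: "\<And>i j A B s. \<lbrakk>i < k; j < k; i \<noteq> j; A \<subseteq> P i; B \<subseteq> P j; n \<le> N * card A; n \<le> N * card B\<rbrakk>
      \<Longrightarrow> \<exists>u\<in>A. \<exists>v\<in>B. {u, v} \<in> E \<and> \<sigma> {u, v} = s"
    and f: "circular_colouring V E \<sigma> r f"
  shows "2 * real k - \<epsilon> \<le> r"
proof (rule ccontr)
  assume "\<not> ?thesis"
  then have r: "r < 2 * real k - \<epsilon>" by simp
  have pos: "0 < \<epsilon> * N" using assms(1,4) by (smt (verit) of_nat_0_less_iff zero_less_numeral order_less_le_trans zero_less_power2 mult_pos_pos)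
  then have N: "0 < N" by (cases N) auto
  with pos have \<epsilon>: "0 < \<epsilon>" by (simp add: zero_less_mult_iff)
  \<comment> \<open>Chosen so that \<open>k * d = k - \<epsilon> / 2\<close>, which exceeds
    \<open>r / 2\<close> because \<open>r < 2 * k - \<epsilon>\<close>.\<close>
  define d where "d = 1 - \<epsilon> / (2 * k)"
  have "0 < d" using assms(1,3) \<epsilon> by (auto simp: d_def field_simps)
  moreover have "k * d = k - \<epsilon> / 2" using assms(1) by (simp add: d_def field_simps)
  ultimately have d: "0 < d" "r / 2 < k * d" using r by auto
  have circ: "f x \<in> circle r" if "x \<in> V" for x
    using f that by (auto simp: circular_colouring_def)
  \<comment> \<open>The index of the arc of length \<open>r / N\<close> that contains
    \<open>f x\<close>.\<close>
  define h where "h x = nat \<lfloor>N * f x / r\<rfloor>" for x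
  have h: "h x < N \<and> h x \<le> N * f x / r \<and> N * f x / r < h x + 1" if "x \<in> V" for x
  proof -
    have "0 \<le> N * f x / r" "N * f x / r < N"
      using circ[OF that] N assms(5) by (auto simp: circle_def field_simps)
    then show ?thesis unfolding h_def by linarith
  qed
  have close: "\<bar>f x - f y\<bar> < r / N" if "x \<in> V" "y \<in> V" "h x = h y" for x y
  proof -
    have "\<bar>N * f x / r - N * f y / r\<bar> < 1" using h[OF that(1)] h[OF that(2)] that(3) by linarith
    then have "\<bar>N / r * (f x - f y)\<bar> < 1" by (simp add: algebra_simps diff_divide_distrib)
    then have "N / r * \<bar>f x - f y\<bar> < 1" using assms(5) unfolding abs_mult by simp
    then show ?thesis using N assms(5) by (simp add: field_simps)
  qed
  have "\<exists>a. n \<le> N * card {x \<in> P i. h x = a}" if "i < k" for i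
    using ex_popular_class[of "P i" n h N] P[OF that] h assms(2) by blast
  then obtain a where a: "\<And>i. i < k \<Longrightarrow> n \<le> N * card {x \<in> P i. h x = a i}" by metis
  define A where "A i = {x \<in> P i. h x = a i}" for i
  have "A i \<noteq> {}" if "i < k" for i using a[OF that] assms(2) by (auto simp: A_def[symmetric])
  then obtain q where q: "\<And>i. i < k \<Longrightarrow> q i \<in> A i" by (meson ex_in_conv)
  obtain i j t where ij: "i < k" "j < k" "i \<noteq> j"
    and t: "\<bar>f (q i) - f (q j) - of_int t * (r / 2)\<bar> < d"
    using close_pair_modulo[of k "r / 2" d "\<lambda>i. f (q i)"] assms(1,5) d by auto
  \<comment> \<open>The parity of \<open>t\<close> tells whether \<open>f (q i)\<close> is close to \<open>f (q j)\<close> or to its antipode.\<close>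
  define s where "s = (if even t then Pos else Neg)"
  obtain u v where uv: "u \<in> A i" "v \<in> A j" "{u, v} \<in> E" "\<sigma> {u, v} = s"
    using hit[OF ij, of "A i" "A j" s] a ij by (auto simp: A_def)
  have V: "A l \<subseteq> V" if "l < k" for l using P[OF that] by (auto simp: A_def)
  \<comment> \<open>This is where \<open>N\<close> has to be of order
    \<open>k\<^sup>2 / \<epsilon>\<close>.\<close>
  have "r / N \<le> \<epsilon> / (4 * k)"
  proof -
    have "r * (4 * real k) \<le> (2 * real k) * (4 * real k)" using r \<epsilon> by (intro mult_right_mono) auto
    then have "r * (4 * real k) \<le> \<epsilon> * N" using assms(4) by (simp add: power2_eq_square)
    then show ?thesis using N assms(1) by (simp add: field_simps)
  qed
  moreover have "\<bar>f u - f (q i)\<bar> < r / N" "\<bar>f v - f (q j)\<bar> < r / N"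
    using close uv q ij V by (auto simp: A_def subset_iff)
  moreover have "\<epsilon> / (2 * k) = \<epsilon> / (4 * k) + \<epsilon> / (4 * k)" by simp
  ultimately have near: "\<bar>f u - f v - of_int t * (r / 2)\<bar> < 1"
    using t unfolding d_def by linarith
  have fuv: "f u \<in> circle r" "f v \<in> circle r" using circ uv V ij by auto
  have edge: "\<sigma> {u, v} = Pos \<longrightarrow> 1 \<le> circ_dist r (f u) (f v)"
      "\<sigma> {u, v} = Neg \<longrightarrow> 1 \<le> circ_dist r (f u) (antipode r (f v))"
    using f uv(3) unfolding circular_colouring_def by blast+
  show False
  proof (cases "even t")
    case True
    then obtain l where "t = 2 * l" by blast
    then have "circ_dist r (f u) (f v) < 1"
      using circ_dist_le[OF fuv, of l] near by simp
    then show False using edge(1) uv(4) True by (simp add: s_def)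
  next
    case False
    then obtain l where "t = 2 * l + 1" using oddE by blast
    then have "circ_dist r (f u) (antipode r (f v)) < 1"
      using circ_dist_antipode_le[OF fuv, of l] near by simp
    then show False using edge(2) uv(4) False by (simp add: s_def)
  qed
qed

section \<open>Choice of parameters and conclusion\<close>

theorem theorem4p4:
  fixes k g :: nat and \<epsilon> :: real
  assumes "k \<ge> 2" and "g \<ge> 2" and "\<epsilon> > 0"
  shows "\<exists>(V :: nat set) (E :: nat set set).
           simple_graph V E \<and> girth E \<ge> enat g \<and> chromatic_number V E = k \<and>
           signed_circular_chromatic_number V E > 2 * real k - \<epsilon>"
proof -
  \<comment> \<open>Being below \<open>\<epsilon>\<close> keeps the final inequality strict after
    passing to an infimum; being at most 1 lets integrality turn
    \<open>2 * k - \<eta> \<le> 2 * q\<close> into \<open>k \<le> q\<close>.\<close>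
  define \<eta> where "\<eta> = min (\<epsilon> / 2) 1"
  have \<eta>: "0 < \<eta>" "\<eta> < \<epsilon>" "\<eta> \<le> 1" using assms by (auto simp: \<eta>_def)
  define N where "N = nat \<lceil>8 * (real k)\<^sup>2 / \<eta>\<rceil> + 1"
  have "8 * (real k)\<^sup>2 / \<eta> \<le> N" unfolding N_def by linarith
  then have N: "0 < N" "8 * (real k)\<^sup>2 \<le> \<eta> * N" using \<eta> by (auto simp: N_def field_simps)
  \<comment> \<open>A class is the fraction \<open>1 / k\<close> of \<open>V\<close>, and a popular
    part is at least the fraction \<open>1 / N\<close> of its class.\<close>
  define \<delta> where "\<delta> = 1 / (real k * real N)"
  have "1 \<le> k * N" using assms(1) N(1) by (simp add: Suc_le_eq)
  then have "1 \<le> real k * real N" by (metis of_nat_1 of_nat_le_iff of_nat_mult)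
  then have \<delta>: "0 < \<delta>" "\<delta> \<le> 1" by (auto simp: \<delta>_def)
  have "(UNIV :: sign set) \<subseteq> {Pos, Neg}" using sign.exhaust by auto
  then have finite_sign: "finite (UNIV :: sign set)" by (rule finite_subset) simp
  obtain m\<^sub>0 where m\<^sub>0: "\<forall>(V :: nat set) \<B>. finite V \<and> m\<^sub>0 \<le> card V \<and>
    \<B> \<subseteq> Pow V \<times> Pow V \<times> (UNIV :: sign set) \<and>
    (\<forall>(A, B, s)\<in>\<B>. \<delta> * card V \<le> card A \<and> \<delta> * card V \<le> card B) \<longrightarrow>
    (\<exists>E \<sigma>. finite E \<and> (\<forall>p. is_cycle E p \<longrightarrow> g \<le> length p) \<and>
      (\<forall>e\<in>E. \<exists>(A, B, s)\<in>\<B>. \<exists>u\<in>A. \<exists>v\<in>B. e = {u, v}) \<and>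
      (\<forall>(A, B, s)\<in>\<B>. \<exists>u\<in>A. \<exists>v\<in>B. {u, v} \<in> E \<and> \<sigma> {u, v} = s))"
    using ex_sparse_hitting_graph[OF \<delta> finite_sign UNIV_not_empty] by (rule exE)
  define n where "n = m\<^sub>0 + 1"
  define V where "V = {..<k * n}"
  \<comment> \<open>Residue classes modulo \<open>k\<close>, so that \<open>x mod k\<close> will be
    a proper colouring.\<close>
  define P where "P i = {x \<in> V. x mod k = i}" for i
  have P_eq: "P i = (\<lambda>j. j * k + i) ` {..<n}" if "i < k" for i
  proof (intro equalityI subsetI)
    fix x assume "x \<in> P i"
    then have "x = x div k * k + i" "x div k < n"
      using that by (auto simp: P_def V_def less_mult_imp_div_less mult.commute)
    then show "x \<in> (\<lambda>j. j * k + i) ` {..<n}" by blast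
  next
    fix x assume "x \<in> (\<lambda>j. j * k + i) ` {..<n}"
    then obtain j where j: "j < n" "x = j * k + i" by auto
    have "j * k + k \<le> n * k" using j(1) by (metis Suc_leI add.commute mult_Suc mult_le_mono1)
    then have "x < k * n" using j(2) that by (simp add: mult.commute)
    then show "x \<in> P i" using j(2) that by (simp add: P_def V_def)
  qed
  have P: "finite (P i) \<and> P i \<subseteq> V \<and> card (P i) = n" if "i < k" for i
  proof -
    have "inj_on (\<lambda>j. j * k + i) {..<n}" using that by (auto simp: inj_on_def)
    then show ?thesis using P_eq[OF that] by (simp add: card_image) (auto simp: P_def)
  qed
  define \<B> where "\<B> = {(A, B, s :: sign). \<exists>i<k. \<exists>j<k. i \<noteq> j \<and> A \<subseteq> P i \<and> B \<subseteq> P j \<and>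
    n \<le> N * card A \<and> n \<le> N * card B}"
  have large: "\<delta> * card V \<le> card A" if "n \<le> N * card A" for A :: "nat set"
  proof -
    have "real n \<le> N * real (card A)" using that by (metis of_nat_le_iff of_nat_mult)
    moreover have "\<delta> * card V = n / N" using assms(1) by (simp add: \<delta>_def V_def)
    ultimately show ?thesis using N(1) by (simp add: pos_divide_le_eq mult.commute)
  qed
  have "n \<le> k * n" using assms(1) by simp
  then have "m\<^sub>0 \<le> k * n" unfolding n_def by linarith
  then have V: "finite V" "m\<^sub>0 \<le> card V" by (auto simp: V_def)
  have \<B>_sub: "\<B> \<subseteq> Pow V \<times> Pow V \<times> UNIV" using P by (force simp: \<B>_def)
  have \<B>_large: "\<forall>(A, B, s)\<in>\<B>. \<delta> * card V \<le> card A \<and> \<delta> * card V \<le> card B"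
    using large by (auto simp: \<B>_def)
  from V \<B>_sub \<B>_large have "finite V \<and> m\<^sub>0 \<le> card V \<and> \<B> \<subseteq> Pow V \<times> Pow V \<times> UNIV \<and>
    (\<forall>(A, B, s)\<in>\<B>. \<delta> * card V \<le> card A \<and> \<delta> * card V \<le> card B)" by (intro conjI)
  from m\<^sub>0[rule_format, OF this] obtain E \<sigma> where E: "finite E" "\<forall>p. is_cycle E p \<longrightarrow> g \<le> length p"
    and edge: "\<forall>e\<in>E. \<exists>(A, B, s)\<in>\<B>. \<exists>u\<in>A. \<exists>v\<in>B. e = {u, v}"
    and hit: "\<forall>(A, B, s)\<in>\<B>. \<exists>u\<in>A. \<exists>v\<in>B. {u, v} \<in> E \<and> \<sigma> {u, v} = s"
    by (elim exE conjE) (rule that; assumption)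
  have edge': "\<exists>u v. e = {u, v} \<and> u \<in> V \<and> v \<in> V \<and> u mod k \<noteq> v mod k" if "e \<in> E" for e
  proof -
    obtain A B s u v where "(A, B, s) \<in> \<B>" and uv: "u \<in> A" "v \<in> B" "e = {u, v}"
      using bspec[OF edge \<open>e \<in> E\<close>] by (auto simp: split_beta)
    then obtain i j where "i \<noteq> j" "A \<subseteq> P i" "B \<subseteq> P j" by (auto simp: \<B>_def)
    then show ?thesis using uv unfolding P_def by blast
  qed
  have ends: "u \<in> V \<and> v \<in> V" "u mod k \<noteq> v mod k" if "{u, v} \<in> E" for u v
    using edge'[OF that] by (auto simp: doubleton_eq_iff)
  \<comment> \<open>The signature may be any \<open>\<tau>\<close> agreeing with
    \<open>\<sigma>\<close> on \<open>E\<close>, since \<open>signatures E\<close> has only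
    extensional members and \<open>restrict \<sigma> E\<close> has to be covered.\<close>
  have radius: "2 * real k - \<eta> \<le> r"
    if "1 \<le> r" "circular_colouring V E \<tau> r f" "\<And>e. e \<in> E \<Longrightarrow> \<tau> e = \<sigma> e" for r f \<tau>
  proof (rule circular_colouring_circumference_ge[OF assms(1) _ \<eta>(3) N(2) that(1) P _ that(2)])
    fix i j A B s
    assume "i < k" "j < k" "i \<noteq> j" "A \<subseteq> P i" "B \<subseteq> P j" "n \<le> N * card A" "n \<le> N * card B"
    then have "(A, B, s) \<in> \<B>" unfolding \<B>_def by blast
    with hit have "\<exists>u\<in>A. \<exists>v\<in>B. {u, v} \<in> E \<and> \<sigma> {u, v} = s" by (auto dest: bspec)
    then obtain u v where "u \<in> A" "v \<in> B" "{u, v} \<in> E" "\<sigma> {u, v} = s" by blast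
    then show "\<exists>u\<in>A. \<exists>v\<in>B. {u, v} \<in> E \<and> \<tau> {u, v} = s"
      using that(3)[of "{u, v}"] by auto
  qed (simp_all add: n_def)
  have colouring: "proper_colouring V E k (\<lambda>x. x mod k)"
    using ends(2) assms(1) by (auto simp: proper_colouring_def)
  have "chromatic_number V E = k"
    unfolding chromatic_number_def
  proof (rule Least_equality)
    fix q assume "\<exists>c. proper_colouring V E q c"
    then obtain c where c: "proper_colouring V E q c" by blast
    \<comment> \<open>A vertex forces \<open>q > 0\<close>, so the circumference
      \<open>2 * q\<close> is at least 1.\<close>
    have "0 \<in> V" using assms(1) by (simp add: V_def n_def)
    then have "0 < q" using c by (auto simp: proper_colouring_def)
    then have "2 * real k - \<eta> \<le> 2 * real q"
      using radius[OF _ circular_colouring_of_proper[OF c ends(1)]] by simp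
    then show "k \<le> q" using \<eta>(3) by linarith
  qed (use colouring in blast)
  moreover have "simple_graph V E"
    using edge' V(1) unfolding simple_graph_def by blast
  moreover have "enat g \<le> girth E"
    using E(2) by (auto simp: girth_def le_INF_iff)
  moreover have "2 * real k - \<epsilon> < signed_circular_chromatic_number V E"
  proof -
    let ?\<tau> = "restrict \<sigma> E"
    have "2 * real k - \<eta> \<le> circular_chromatic_number V E ?\<tau>"
      unfolding circular_chromatic_number_def
    proof (rule cInf_greatest)
      \<comment> \<open>A lower bound on a real infimum requires a nonempty set; the colouring by
        residues supplies the member \<open>2 * k\<close>.\<close>
      have "1 \<le> 2 * real k" using assms(1) by simp
      then show "{r. 1 \<le> r \<and> (\<exists>f. circular_colouring V E ?\<tau> r f)} \<noteq> {}"
        using circular_colouring_of_proper[OF colouring ends(1)] by blast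
    qed (use radius in auto)
    moreover have "finite (signatures E)"
      unfolding signatures_def using E(1) finite_sign by (intro finite_PiE) auto
    then have "circular_chromatic_number V E ?\<tau> \<le> signed_circular_chromatic_number V E"
      unfolding signed_circular_chromatic_number_def
      by (intro Max_ge) (auto simp: signatures_def)
    ultimately show ?thesis using \<eta>(2) by linarith
  qed
  ultimately show ?thesis by blast
qed

end
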